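(* Let $A$ (with values $a,\neg a$) and $C$ (with values $c,\neg c$) be binary variables joined by a link $A\rightarrow C$ quantified by fixed conditional probabilities. Then for all $x\in\{c,\neg c\}$ and $y\in\{a,\neg a\}$: (i) $p(x)$ follows $p(y)$ if and only if $p(x\mid y)>p(x\mid\neg y)$; (ii) $p(x)$ varies inversely with $p(y)$ if and only if $p(x\mid y)<p(x\mid\neg y)$; (iii) $p(x)$ is independent of $p(y)$ if and only if $p(x\mid y)=p(x\mid\neg y)$.
   Context: Convention: $\neg\neg a=a$ and $\neg\neg c=c$. The conditional probabilities $p(x\mid y)$, $x\in\{c,\neg c\}$, $y\in\{a,\neg a\}$, are constants in $[0,1]$ with $p(c\mid y)+p(\neg c\mid y)=1$. The value $p(a)\in[0,1]$ varies, with $p(\neg a)=1-p(a)$, and the probabilities at $C$ are determined by $p(x)=p(a)\,p(x\mid a)+p(\neg a)\,p(x\mid\neg a)$ for $x\in\{c,\neg c\}$. Thus $p(x)$ is regarded as a function of $p(y)\in[0,1]$. Definitions: $p(x)$ *follows* $p(y)$ if $p(x)$ increases when $p(y)$ increases and decreases when $p(y)$ decreases; $p(x)$ *varies inversely with* $p(y)$ if $p(x)$ decreases when $p(y)$ increases and increases when $p(y)$ decreases; $p(x)$ is *independent of* $p(y)$ if $p(x)$ does not change as $p(y)$ increases and decreases. (Increase and decrease are strict; equivalently, the derivative of $p(x)$ with respect to $p(y)$ is respectively positive, negative, zero.) *)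

theory Defs
  imports "HOL-Analysis.Analysis"
begin

text \<open>
  The values of a binary variable are encoded by \<^typ>\<open>bool\<close>: for the variable A, the value a is
  \<^const>\<open>True\<close> and its negation is \<^const>\<open>False\<close>; likewise for C and c. Negation of values is
  \<^const>\<open>Not\<close>, so double negation of a value is that value.
\<close>

text \<open>\<open>q x y\<close> stands for the conditional probability p(x | y), with x a value of C and y a value of A.\<close>

definition binary_link :: "(bool \<Rightarrow> bool \<Rightarrow> real) \<Rightarrow> bool" where
  "binary_link q \<longleftrightarrow>
     (\<forall>x y. 0 \<le> q x y \<and> q x y \<le> 1) \<and> (\<forall>y. q True y + q False y = 1)"

text \<open>The probabilities at A determined by p(y) = t.\<close>

definition prob_A :: "bool \<Rightarrow> real \<Rightarrow> bool \<Rightarrow> real" where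
  "prob_A y t z = (if z = y then t else 1 - t)"

definition prob_C :: "(bool \<Rightarrow> bool \<Rightarrow> real) \<Rightarrow> (bool \<Rightarrow> real) \<Rightarrow> bool \<Rightarrow> real" where
  "prob_C q P x = P True * q x True + P False * q x False"

text \<open>p(x) regarded as a function of t = p(y); only arguments t in the unit interval are meaningful.\<close>

definition prob_fun :: "(bool \<Rightarrow> bool \<Rightarrow> real) \<Rightarrow> bool \<Rightarrow> bool \<Rightarrow> real \<Rightarrow> real" where
  "prob_fun q x y t = prob_C q (prob_A y t) x"

definition follows :: "(bool \<Rightarrow> bool \<Rightarrow> real) \<Rightarrow> bool \<Rightarrow> bool \<Rightarrow> bool" where
  "follows q x y \<longleftrightarrow> strict_mono_on {0..1} (prob_fun q x y)"

definition varies_inversely :: "(bool \<Rightarrow> bool \<Rightarrow> real) \<Rightarrow> bool \<Rightarrow> bool \<Rightarrow> bool" where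
  "varies_inversely q x y \<longleftrightarrow> strict_antimono_on {0..1} (prob_fun q x y)"

definition independent_of :: "(bool \<Rightarrow> bool \<Rightarrow> real) \<Rightarrow> bool \<Rightarrow> bool \<Rightarrow> bool" where
  "independent_of q x y \<longleftrightarrow> prob_fun q x y constant_on {0..1}"

end

theory Submission
  imports Defs
begin

text \<open>By total probability, p(x) is affine in t = p(y), with slope
  \<open>q x y - q x (\<not> y)\<close>, so the sign of this slope decides how p(x) behaves
  (\<open>prob_fun_affine\<close>). The three lemmas on \<open>b + t * m\<close> turn each behaviour
  on [0,1] into a sign condition on \<open>m\<close>.\<close>

lemma prob_fun_affine:
  "prob_fun q x y t = q x (\<not> y) + t * (q x y - q x (\<not> y))"
  \<comment> \<open>\<open>prob_C\<close> sums over \<open>True\<close> and \<open>False\<close>,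
    whereas \<open>prob_A\<close> is stated relative to \<open>y\<close>; fixing \<open>y\<close>
    matches the two.\<close>
  by (cases y) (simp_all add: prob_fun_def prob_C_def prob_A_def algebra_simps)

text \<open>The endpoints 0 and 1 already reveal the sign of \<open>m\<close>, since the values
  there differ by exactly \<open>m\<close>.\<close>

lemma strict_mono_on_affine_iff:
  fixes b m :: real
  shows "strict_mono_on {0..1} (\<lambda>t. b + t * m) \<longleftrightarrow> 0 < m"
proof
  assume "strict_mono_on {0..1} (\<lambda>t. b + t * m)"
  from strict_mono_onD[OF this, of 0 1] show "0 < m"
    by simp
qed (simp add: strict_mono_on_def)

lemma strict_antimono_on_affine_iff:
  fixes b m :: real
  shows "strict_antimono_on {0..1} (\<lambda>t. b + t * m) \<longleftrightarrow> m < 0"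
proof
  assume "strict_antimono_on {0..1} (\<lambda>t. b + t * m)"
  from monotone_onD[OF this, of 0 1] show "m < 0"
    by simp
qed (simp add: monotone_on_def)

lemma constant_on_affine_iff:
  fixes b m :: real
  shows "(\<lambda>t. b + t * m) constant_on {0..1} \<longleftrightarrow> m = 0"
proof
  assume "(\<lambda>t. b + t * m) constant_on {0..1}"
  then obtain c where c: "b + t * m = c" if "t \<in> {0..1}" for t
    unfolding constant_on_def by blast
  \<comment> \<open>The endpoint values \<open>b\<close> and \<open>b + m\<close> both equal
    \<open>c\<close>.\<close>
  from c[of 0] c[of 1] show "m = 0"
    by simp
qed (simp add: constant_on_def)

theorem theorem3p1:
  fixes q :: "bool \<Rightarrow> bool \<Rightarrow> real"
  assumes "binary_link q"
  shows "\<forall>x y.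
    (follows q x y \<longleftrightarrow> q x y > q x (\<not> y)) \<and>
    (varies_inversely q x y \<longleftrightarrow> q x y < q x (\<not> y)) \<and>
    (independent_of q x y \<longleftrightarrow> q x y = q x (\<not> y))"
  \<comment> \<open>The three notions concern the function itself, so the affine form enters as an
    equation between functions.\<close>
  by (simp add: follows_def varies_inversely_def independent_of_def
      prob_fun_affine[abs_def] strict_mono_on_affine_iff
      strict_antimono_on_affine_iff constant_on_affine_iff)

end
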